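(* Let $H$ be a countable group and $\mu$ a probability measure on $\mathsf{Shuffler}(H)=\mathrm{FSym}(H)\rtimes H$. Suppose that $\mu$ induces a transient random walk on $H$ and that $\mathbb{E}(|\mathrm{supp}(\sigma_1)|)=\sum_{(f,y)\in\mathsf{Shuffler}(H)}|\mathrm{supp}(f)|\,\mu(f,y)<\infty$, where $\sigma_1$ denotes the $\mathrm{FSym}(H)$-component of a $\mu$-distributed increment. Then the permutation coordinate $\{F_n\}$ of the $\mu$-random walk $\{(F_n,S_n)\}_{n\ge0}$ on $\mathsf{Shuffler}(H)$ stabilizes: almost surely, for every $h\in H$ there exists $N\ge1$ such that $F_n(h)=F_N(h)$ for all $n\ge N$.
   Context: For a countable group $H$, $\mathrm{FSym}(H)$ is the group (under composition) of bijections $f:H\to H$ with finite support $\mathrm{supp}(f)=\{h\in H: f(h)\neq h\}$. $H$ acts on it by $(h\cdot f)(x)=hf(h^{-1}x)$, and $\mathsf{Shuffler}(H):=\mathrm{FSym}(H)\rtimes H$ with product $(f,x)(g,y)=(f\circ(x\cdot g),xy)$. The $\mu$-random walk is $(F_n,S_n)=g_1g_2\cdots g_n$ with $g_i=(\sigma_i,X_i)$ i.i.d. of law $\mu$, started at the identity; $F_n\in\mathrm{FSym}(H)$ is the permutation coordinate and $S_n\in H$. The induced random walk on $H$ is $\{S_n\}$ (driven by the push-forward of $\mu$ under the projection to $H$); it is transient if almost surely it visits $e_H$ only finitely many times. *)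

theory Defs
  imports
    "HOL-Algebra.Group"
    "HOL-Combinatorics.Permutations"
    "HOL-Probability.Probability"
begin

definition supp :: "('a, 'm) monoid_scheme \<Rightarrow> ('a \<Rightarrow> 'a) \<Rightarrow> 'a set" where
  "supp H f = {h \<in> carrier H. f h \<noteq> h}"

text \<open>
  A bijection of \<open>carrier H\<close> is represented by its extension to the whole type by the identity,
  which is what \<open>permutes\<close> expresses.
\<close>

definition FSym :: "('a, 'm) monoid_scheme \<Rightarrow> ('a \<Rightarrow> 'a) set" where
  "FSym H = {f. f permutes carrier H \<and> finite (supp H f)}"

definition act :: "('a, 'm) monoid_scheme \<Rightarrow> 'a \<Rightarrow> ('a \<Rightarrow> 'a) \<Rightarrow> 'a \<Rightarrow> 'a" where
  "act H h f = (\<lambda>x. if x \<in> carrier H then h \<otimes>\<^bsub>H\<^esub> f (inv\<^bsub>H\<^esub> h \<otimes>\<^bsub>H\<^esub> x) else x)"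

definition Shuffler :: "('a, 'm) monoid_scheme \<Rightarrow> (('a \<Rightarrow> 'a) \<times> 'a) monoid" where
  "Shuffler H =
    \<lparr>carrier = FSym H \<times> carrier H,
     monoid.mult = (\<lambda>(f, x) (g, y). (f \<circ> act H x g, x \<otimes>\<^bsub>H\<^esub> y)),
     one = (id, \<one>\<^bsub>H\<^esub>)\<rparr>"

text \<open>The increments are indexed from 1; the value of \<open>g 0\<close> is never used.\<close>

primrec random_walk :: "('g, 'm) monoid_scheme \<Rightarrow> (nat \<Rightarrow> 'w \<Rightarrow> 'g) \<Rightarrow> nat \<Rightarrow> 'w \<Rightarrow> 'g" where
  "random_walk G g 0 \<omega> = \<one>\<^bsub>G\<^esub>"
| "random_walk G g (Suc n) \<omega> = random_walk G g n \<omega> \<otimes>\<^bsub>G\<^esub> g (Suc n) \<omega>"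

definition iid_increments :: "'w measure \<Rightarrow> 'g pmf \<Rightarrow> (nat \<Rightarrow> 'w \<Rightarrow> 'g) \<Rightarrow> bool" where
  "iid_increments M \<mu> g \<longleftrightarrow>
    prob_space.indep_vars M (\<lambda>_. count_space UNIV) g {1..} \<and>
    (\<forall>i\<ge>1. distr M (count_space UNIV) (g i) = measure_pmf \<mu>)"

definition transient ::
  "'w measure \<Rightarrow> ('g, 'm) monoid_scheme \<Rightarrow> (nat \<Rightarrow> 'w \<Rightarrow> 'g) \<Rightarrow> bool" where
  "transient M G S \<longleftrightarrow> (AE \<omega> in M. finite {n. S n \<omega> = \<one>\<^bsub>G\<^esub>})"

lemma supp_act:
  assumes "group H" "h \<in> carrier H" "f \<in> FSym H"
  shows "supp H (act H h f) = (\<lambda>x. h \<otimes>\<^bsub>H\<^esub> x) ` supp H f"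
proof -
  interpret group H by fact
  have f: "f x \<in> carrier H" if "x \<in> carrier H" for x
    using assms(3) that by (auto simp: FSym_def permutes_in_image)
  show ?thesis
  proof (intro equalityI subsetI)
    fix x assume "x \<in> supp H (act H h f)"
    then have x: "x \<in> carrier H" "h \<otimes>\<^bsub>H\<^esub> f (inv\<^bsub>H\<^esub> h \<otimes>\<^bsub>H\<^esub> x) \<noteq> x"
      by (auto simp: supp_def act_def)
    have "h \<otimes>\<^bsub>H\<^esub> (inv\<^bsub>H\<^esub> h \<otimes>\<^bsub>H\<^esub> x) = x"
      using x assms(2) by (simp add: m_assoc[symmetric])
    with x assms(2) show "x \<in> (\<lambda>x. h \<otimes>\<^bsub>H\<^esub> x) ` supp H f"
      by (intro image_eqI[of _ _ "inv\<^bsub>H\<^esub> h \<otimes>\<^bsub>H\<^esub> x"]) (auto simp: supp_def)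
  next
    fix x assume "x \<in> (\<lambda>x. h \<otimes>\<^bsub>H\<^esub> x) ` supp H f"
    then obtain y where y: "y \<in> carrier H" "f y \<noteq> y" "x = h \<otimes>\<^bsub>H\<^esub> y"
      by (auto simp: supp_def)
    have "inv\<^bsub>H\<^esub> h \<otimes>\<^bsub>H\<^esub> x = y"
      using y assms(2) by (simp add: m_assoc[symmetric])
    with y assms(2) f show "x \<in> supp H (act H h f)"
      by (auto simp: supp_def act_def)
  qed
qed

lemma act_FSym:
  assumes "group H" "h \<in> carrier H" "f \<in> FSym H"
  shows "act H h f \<in> FSym H"
proof -
  interpret group H by fact
  have fp: "f permutes carrier H" and fin: "finite (supp H f)"
    using assms(3) by (auto simp: FSym_def)
  have f: "f x \<in> carrier H" if "x \<in> carrier H" for x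
    using fp that by (simp add: permutes_in_image)
  have f': "inv_into UNIV f x \<in> carrier H" if "x \<in> carrier H" for x
    using permutes_inv[OF fp] that by (simp add: permutes_in_image)
  have ff': "f (inv_into UNIV f x) = x" "inv_into UNIV f (f x) = x" for x
    using permutes_inverses[OF fp] by auto
  have c: "h \<otimes>\<^bsub>H\<^esub> (inv\<^bsub>H\<^esub> h \<otimes>\<^bsub>H\<^esub> x) = x" "inv\<^bsub>H\<^esub> h \<otimes>\<^bsub>H\<^esub> (h \<otimes>\<^bsub>H\<^esub> x) = x"
    if "x \<in> carrier H" for x
    using that assms(2) by (simp_all add: m_assoc[symmetric])
  have "bij_betw (act H h f) (carrier H) (carrier H)"
    by (rule bij_betw_byWitness[where f' = "act H h (inv_into UNIV f)"])
       (simp_all add: act_def image_subset_iff assms(2) f f' c ff')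
  then have "act H h f permutes carrier H"
    by (rule bij_imp_permutes) (simp add: act_def)
  with fin show ?thesis
    using supp_act[OF assms] by (simp add: FSym_def)
qed

lemma comp_FSym:
  assumes "f \<in> FSym H" "g \<in> FSym H"
  shows "f \<circ> g \<in> FSym H"
proof -
  have "supp H (f \<circ> g) \<subseteq> supp H f \<union> supp H g"
    by (auto simp: supp_def)
  with assms show ?thesis
    by (auto simp: FSym_def intro: permutes_compose finite_subset)
qed

lemma inv_FSym:
  assumes "f \<in> FSym H"
  shows "inv_into UNIV f \<in> FSym H"
proof -
  have fp: "f permutes carrier H" using assms by (simp add: FSym_def)
  have "supp H (inv_into UNIV f) \<subseteq> supp H f"
    using permutes_inverses[OF fp] by (auto simp: supp_def) metis
  with assms show ?thesis
    by (auto simp: FSym_def intro: permutes_inv finite_subset)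
qed

lemma group_Shuffler:
  assumes "group H"
  shows "group (Shuffler H)"
proof -
  interpret group H by fact
  have in_c: "f x \<in> carrier H" if "f \<in> FSym H" "x \<in> carrier H" for f x
    using that by (auto simp: FSym_def permutes_in_image)
  have out: "f x = x" if "f \<in> FSym H" "x \<notin> carrier H" for f x
    using that by (auto simp: FSym_def permutes_def)
  have act_comp: "act H x (f \<circ> g) = act H x f \<circ> act H x g"
    if "x \<in> carrier H" "f \<in> FSym H" "g \<in> FSym H" for x f g
    using that in_c by (auto simp: act_def fun_eq_iff m_assoc[symmetric])
  have act_mult: "act H x (act H y f) = act H (x \<otimes>\<^bsub>H\<^esub> y) f"
    if "x \<in> carrier H" "y \<in> carrier H" "f \<in> FSym H" for x y f
    using that in_c by (auto simp: act_def fun_eq_iff m_assoc inv_mult_group)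
  have act_one: "act H \<one>\<^bsub>H\<^esub> f = f" if "f \<in> FSym H" for f
    using in_c[OF that] out[OF that] by (simp add: act_def fun_eq_iff)
  have act_id: "act H x id = id" if "x \<in> carrier H" for x
    using that by (auto simp: act_def fun_eq_iff m_assoc[symmetric])
  have id: "id \<in> FSym H"
    by (simp add: FSym_def supp_def permutes_id)
  show ?thesis
  proof (rule groupI)
    fix a b assume "a \<in> carrier (Shuffler H)" "b \<in> carrier (Shuffler H)"
    then show "a \<otimes>\<^bsub>Shuffler H\<^esub> b \<in> carrier (Shuffler H)"
      by (auto simp: Shuffler_def comp_FSym act_FSym[OF assms])
  next
    show "\<one>\<^bsub>Shuffler H\<^esub> \<in> carrier (Shuffler H)"
      by (simp add: Shuffler_def id)
  next
    fix a b c assume "a \<in> carrier (Shuffler H)" "b \<in> carrier (Shuffler H)" "c \<in> carrier (Shuffler H)"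
    then show "a \<otimes>\<^bsub>Shuffler H\<^esub> b \<otimes>\<^bsub>Shuffler H\<^esub> c = a \<otimes>\<^bsub>Shuffler H\<^esub> (b \<otimes>\<^bsub>Shuffler H\<^esub> c)"
      by (auto simp: Shuffler_def act_comp act_FSym[OF assms] act_mult m_assoc comp_assoc)
  next
    fix a assume "a \<in> carrier (Shuffler H)"
    then show "\<one>\<^bsub>Shuffler H\<^esub> \<otimes>\<^bsub>Shuffler H\<^esub> a = a"
      by (auto simp: Shuffler_def act_one)
  next
    fix a assume "a \<in> carrier (Shuffler H)"
    then obtain f x where a: "a = (f, x)" "f \<in> FSym H" "x \<in> carrier H"
      by (auto simp: Shuffler_def)
    have "act H (inv\<^bsub>H\<^esub> x) (inv_into UNIV f) \<circ> act H (inv\<^bsub>H\<^esub> x) f = id"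
      using a act_comp[of "inv\<^bsub>H\<^esub> x" "inv_into UNIV f" f] act_id[of "inv\<^bsub>H\<^esub> x"]
        inv_FSym[OF a(2)] permutes_inv_o(2)[of f "carrier H"]
      by (simp add: FSym_def)
    with a show "\<exists>b\<in>carrier (Shuffler H). b \<otimes>\<^bsub>Shuffler H\<^esub> a = \<one>\<^bsub>Shuffler H\<^esub>"
      by (intro bexI[of _ "(act H (inv\<^bsub>H\<^esub> x) (inv_into UNIV f), inv\<^bsub>H\<^esub> x)"])
         (auto simp: Shuffler_def act_FSym[OF assms] inv_FSym)
  qed
qed

lemma snd_random_walk_Shuffler:
  "snd (random_walk (Shuffler H) g n \<omega>) = random_walk H (\<lambda>i \<omega>. snd (g i \<omega>)) n \<omega>"
  by (induction n) (auto simp: Shuffler_def split: prod.splits)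

lemma expected_supp_eq_sum:
  assumes "set_pmf \<mu> \<subseteq> carrier (Shuffler H)"
  shows "(\<integral>\<^sup>+(f, y). of_nat (card (supp H f)) \<partial>measure_pmf \<mu>) =
    (\<integral>\<^sup>+(f, y). of_nat (card (supp H f)) * ennreal (pmf \<mu> (f, y))
      \<partial>count_space (carrier (Shuffler H)))"
proof -
  have "(\<integral>\<^sup>+(f, y). of_nat (card (supp H f)) \<partial>measure_pmf \<mu>) =
    (\<integral>\<^sup>+(f, y). of_nat (card (supp H f)) * ennreal (pmf \<mu> (f, y)) \<partial>count_space UNIV)"
    by (simp add: nn_integral_measure_pmf case_prod_unfold mult.commute)
  also have "\<dots> = (\<integral>\<^sup>+(f, y). of_nat (card (supp H f)) * ennreal (pmf \<mu> (f, y))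
      \<partial>count_space (carrier (Shuffler H)))"
    using assms by (intro nn_integral_count_space_eq) (auto simp: set_pmf_iff)
  finally show ?thesis .
qed

end

theory Submission
  imports Defs
begin

text \<open>
  Passing from time \<open>n\<close> to \<open>n + 1\<close> changes the image of \<open>h\<close> only if \<open>S\<^sub>n\<inverse> h\<close> lies in the support
  of \<open>\<sigma>\<^sub>n\<^sub>+\<^sub>1\<close>, which is independent of \<open>S\<^sub>n\<close>. The probabilities of these events sum to at most
  \<open>sup\<^sub>x G(x) \<cdot> E|supp \<sigma>\<^sub>1|\<close> for the Green function \<open>G(x) = \<Sum>\<^sub>n P(S\<^sub>n = x)\<close>, and Borel-Cantelli applies.
  Boundedness of the Green function follows by decomposing at the last visit: if \<open>q\<close> is the
  probability of never returning to the identity, then \<open>P(S\<^sub>n = x) q\<close> is the probability that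
  the last visit to \<open>x\<close> is at time \<open>n\<close>, so \<open>G(x) q \<le> 1\<close>; for \<open>x = e\<close>, transience turns this into
  an equality, whence \<open>q > 0\<close>.
\<close>

section \<open>Walks on a countable group driven by i.i.d. increments\<close>

text \<open>Increments keep their own type \<open>'g\<close> and reach the group through
  \<open>step\<close>: an increment of the Shuffler also carries a permutation, and whether a point
  gets moved depends on that permutation.\<close>

locale iid_group_walk = group G + prob_space M
  for G :: "('a, 'm) monoid_scheme" and M :: "'w measure" +
  fixes \<mu> :: "'g pmf" and g :: "nat \<Rightarrow> 'w \<Rightarrow> 'g" and step :: "'g \<Rightarrow> 'a"
  assumes countable_carrier: "countable (carrier G)"
    and iid: "iid_increments M \<mu> g"
    and step_closed [simp]: "step u \<in> carrier G"
begin

text \<open>A function of the increment sequence rather than of the sample point, so that it applies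
  equally to all increments and to those after a given time.\<close>

definition pos :: "nat \<Rightarrow> (nat \<Rightarrow> 'g) \<Rightarrow> 'a" where
  "pos n s = random_walk G (\<lambda>i s. step (s i)) n s"

definition law :: "(nat \<Rightarrow> 'g) measure" where
  "law = PiM {1..} (\<lambda>_. measure_pmf \<mu>)"

text \<open>The restriction to indices from 1 on makes the shifted sequence a point of the product
  space that carries \<open>law\<close>.\<close>

definition shift :: "nat \<Rightarrow> 'w \<Rightarrow> nat \<Rightarrow> 'g" where
  "shift n \<omega> = (\<lambda>i\<in>{1..}. g (n + i) \<omega>)"

lemma pos_0 [simp]: "pos 0 s = \<one>\<^bsub>G\<^esub>"
  by (simp add: pos_def)

lemma pos_Suc: "pos (Suc n) s = pos n s \<otimes>\<^bsub>G\<^esub> step (s (Suc n))"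
  by (simp add: pos_def)

lemma pos_closed [simp]: "pos n s \<in> carrier G"
  by (induction n) (simp_all add: pos_Suc)

lemma pos_cong: "(\<And>i. i \<in> {1..n} \<Longrightarrow> s i = t i) \<Longrightarrow> pos n s = pos n t"
  by (induction n) (simp_all add: pos_Suc)

lemma pos_add: "pos (n + k) s = pos n s \<otimes>\<^bsub>G\<^esub> pos k (\<lambda>i. s (n + i))"
  by (induction k) (simp_all add: pos_Suc m_assoc)

lemma pos_shift: "pos k (shift n \<omega>) = pos k (\<lambda>i. g (n + i) \<omega>)"
  by (rule pos_cong) (simp add: shift_def)

text \<open>For each fixed current position, multiplying by the next step is measurable;
  countability of the carrier glues these maps along the current position, measurable by
  induction.\<close>

lemma measurable_pos:
  assumes "{1..n} \<subseteq> J"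
  shows "pos n \<in> PiM J (\<lambda>_. count_space UNIV) \<rightarrow>\<^sub>M count_space (carrier G)"
  using assms
proof (induction n)
  case 0
  then show ?case by (simp add: pos_def)
next
  case (Suc n)
  have "(\<lambda>s. s (Suc n)) \<in> PiM J (\<lambda>_. count_space UNIV) \<rightarrow>\<^sub>M count_space (UNIV :: 'g set)"
    using Suc.prems by (intro measurable_component_singleton) auto
  then have "(\<lambda>s. x \<otimes>\<^bsub>G\<^esub> step (s (Suc n))) \<in> PiM J (\<lambda>_. count_space UNIV) \<rightarrow>\<^sub>M count_space (carrier G)"
    if "x \<in> carrier G" for x
    by (rule measurable_compose) (use that in auto)
  moreover have "pos n \<in> PiM J (\<lambda>_. count_space UNIV) \<rightarrow>\<^sub>M count_space (carrier G)"
    using Suc.prems by (intro Suc.IH) auto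
  ultimately show ?case
    unfolding pos_Suc by (rule measurable_compose_countable'[OF _ _ countable_carrier])
qed

section \<open>Measurability and law of the increments\<close>

lemma indep_increments: "indep_vars (\<lambda>_. count_space UNIV) g {1..}"
  and distr_increment: "i \<ge> 1 \<Longrightarrow> distr M (count_space UNIV) (g i) = measure_pmf \<mu>"
  using iid by (simp_all add: iid_increments_def)

lemma measurable_increment: "i \<ge> 1 \<Longrightarrow> g i \<in> M \<rightarrow>\<^sub>M count_space UNIV"
  using indep_increments by (auto simp: indep_vars_def)

lemma sets_law: "sets law = sets (PiM {1..} (\<lambda>_. count_space UNIV))"
  unfolding law_def by (rule sets_PiM_cong) auto

lemma measurable_shift: "shift n \<in> M \<rightarrow>\<^sub>M PiM {1..} (\<lambda>_. count_space UNIV)"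
  unfolding shift_def by (intro measurable_restrict measurable_increment) auto

lemma measurable_pos_walk: "(\<lambda>\<omega>. pos n (\<lambda>i. g i \<omega>)) \<in> M \<rightarrow>\<^sub>M count_space (carrier G)"
  using measurable_compose[OF measurable_shift[of 0] measurable_pos[of n "{1..}"]]
  by (simp add: pos_shift)

lemma sets_pos_walk [measurable]: "{\<omega> \<in> space M. pos n (\<lambda>i. g i \<omega>) = x} \<in> events"
proof (cases "x \<in> carrier G")
  case True
  then show ?thesis
    using measurable_sets[OF measurable_pos_walk, of "{x}" n] by (simp add: vimage_def Int_def conj_commute)
next
  case False
  then have "{\<omega> \<in> space M. pos n (\<lambda>i. g i \<omega>) = x} = {}"
    using pos_closed by blast
  then show ?thesis by (simp only: sets.empty_sets)
qed

lemma measurable_reindex: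
  "(\<lambda>s. \<lambda>i\<in>{1..}. s (n + i)) \<in>
    PiM {Suc n..} (\<lambda>_. count_space UNIV) \<rightarrow>\<^sub>M PiM {1..} (\<lambda>_. count_space (UNIV :: 'g set))"
  by (intro measurable_restrict measurable_component_singleton) auto

text \<open>The shifted sequence depends only on the block of increments after time
  \<open>n\<close>, the form in which independence of blocks can be used.\<close>

lemma shift_eq_reindex: "shift n \<omega> = (\<lambda>i\<in>{1..}. (\<lambda>i\<in>{Suc n..}. g i \<omega>) (n + i))"
  by (auto simp: shift_def fun_eq_iff)

text \<open>By independence the block after time \<open>n\<close> has a product law, and the
  injective renumbering of \<open>i\<close> as \<open>n + i\<close> turns it into the product over
  the indices from 1 on.\<close>

lemma distr_shift: "distr M (PiM {1..} (\<lambda>_. count_space UNIV)) (shift n) = law"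
proof -
  let ?C = "\<lambda>_. count_space UNIV :: 'g measure"
  let ?P = "\<lambda>_. measure_pmf \<mu>"
  let ?X = "\<lambda>\<omega>. \<lambda>i\<in>{Suc n..}. g i \<omega>"
  have "indep_vars ?C g {Suc n..}"
    by (rule indep_vars_subset[OF indep_increments]) auto
  then have "distr M (PiM {Suc n..} ?C) ?X = PiM {Suc n..} (\<lambda>i. distr M (count_space UNIV) (g i))"
    by (subst (asm) indep_vars_iff_distr_eq_PiM') (auto intro: measurable_increment)
  also have "\<dots> = PiM {Suc n..} ?P"
    by (rule PiM_cong) (auto intro: distr_increment)
  finally have X: "distr M (PiM {Suc n..} ?C) ?X = PiM {Suc n..} ?P" .
  have X_meas: "?X \<in> M \<rightarrow>\<^sub>M PiM {Suc n..} ?C"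
    by (intro measurable_restrict measurable_increment) auto
  have "distr M (PiM {1..} ?C) (shift n) =
      distr M (PiM {1..} ?C) ((\<lambda>s. \<lambda>i\<in>{1..}. s (n + i)) \<circ> ?X)"
    by (rule arg_cong[where f = "distr M _"], rule ext) (simp only: comp_def shift_eq_reindex)
  also have "\<dots> = distr (distr M (PiM {Suc n..} ?C) ?X) (PiM {1..} ?C) (\<lambda>s. \<lambda>i\<in>{1..}. s (n + i))"
    by (rule distr_distr[symmetric, OF measurable_reindex X_meas])
  also have "\<dots> = distr (PiM {Suc n..} ?P) (PiM {1..} ?P) (\<lambda>s. \<lambda>i\<in>{1..}. s (n + i))"
    unfolding X by (rule distr_cong) (auto intro!: sets_PiM_cong)
  also have "\<dots> = PiM {1..} ?P"
    by (rule distr_PiM_reindex) (auto simp: prob_space_measure_pmf inj_on_def)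
  finally show ?thesis
    by (simp add: law_def)
qed

section \<open>The Markov property\<close>

text \<open>The position at time \<open>n\<close> is a function of the increments up to
  \<open>n\<close>, the shifted sequence of those after \<open>n\<close>. The two blocks are
  independent, and \<open>distr_shift\<close> identifies the second factor.\<close>

lemma markov:
  assumes "x \<in> carrier G" and B: "B \<in> sets law"
  shows "emeasure M {\<omega> \<in> space M. pos n (\<lambda>i. g i \<omega>) = x \<and> shift n \<omega> \<in> B} =
    emeasure M {\<omega> \<in> space M. pos n (\<lambda>i. g i \<omega>) = x} * emeasure law B"
proof -
  let ?C = "\<lambda>_. count_space UNIV :: 'g measure"
  let ?R = "\<lambda>s. \<lambda>i\<in>{1..}. s (n + i)"
  have B': "B \<in> sets (PiM {1..} ?C)"
    using B by (simp add: sets_law)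
  have "indep_var (PiM {1..n} ?C) (\<lambda>\<omega>. \<lambda>i\<in>{1..n}. g i \<omega>)
      (PiM {Suc n..} ?C) (\<lambda>\<omega>. \<lambda>i\<in>{Suc n..}. g i \<omega>)"
    by (rule indep_var_restrict[OF indep_increments]) auto
  then have "prob ((\<lambda>\<omega>. (\<lambda>i\<in>{1..n}. g i \<omega>, \<lambda>i\<in>{Suc n..}. g i \<omega>)) -`
        ((pos n -` {x} \<inter> space (PiM {1..n} ?C)) \<times> (?R -` B \<inter> space (PiM {Suc n..} ?C))) \<inter> space M) =
      prob ((\<lambda>\<omega>. \<lambda>i\<in>{1..n}. g i \<omega>) -` (pos n -` {x} \<inter> space (PiM {1..n} ?C)) \<inter> space M) *
      prob ((\<lambda>\<omega>. \<lambda>i\<in>{Suc n..}. g i \<omega>) -` (?R -` B \<inter> space (PiM {Suc n..} ?C)) \<inter> space M)"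
    by (rule indep_varD)
       (use assms(1) in \<open>auto intro!: measurable_sets[OF measurable_pos] measurable_sets[OF measurable_reindex B', simplified]\<close>)
  moreover have "pos n (\<lambda>i\<in>{1..n}. g i \<omega>) = pos n (\<lambda>i. g i \<omega>)" for \<omega>
    by (rule pos_cong) simp
  moreover have "?R (\<lambda>i\<in>{Suc n..}. g i \<omega>) = shift n \<omega>" for \<omega>
    by (rule shift_eq_reindex[symmetric])
  ultimately have "prob {\<omega> \<in> space M. pos n (\<lambda>i. g i \<omega>) = x \<and> shift n \<omega> \<in> B} =
      prob {\<omega> \<in> space M. pos n (\<lambda>i. g i \<omega>) = x} * prob (shift n -` B \<inter> space M)"
    by (simp add: vimage_def Int_def space_PiM conj_commute)
  moreover have "emeasure law B = prob (shift n -` B \<inter> space M)"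
    using emeasure_distr[OF measurable_shift[of n] B'] by (simp only: distr_shift emeasure_eq_measure)
  ultimately show ?thesis
    by (simp add: emeasure_eq_measure ennreal_mult'')
qed

section \<open>Last visits and the Green function\<close>

text \<open>Time 0 is excluded because the walk starts at the identity.\<close>

definition escape :: "(nat \<Rightarrow> 'g) set" where
  "escape = {s \<in> space law. \<forall>k\<ge>1. pos k s \<noteq> \<one>\<^bsub>G\<^esub>}"

lemma sets_escape: "escape \<in> sets law"
proof -
  have "{s \<in> space law. pos k s \<noteq> \<one>\<^bsub>G\<^esub>} \<in> sets law" for k
  proof -
    have "pos k -` (carrier G - {\<one>\<^bsub>G\<^esub>}) \<inter> space law \<in> sets law"
      using measurable_sets[OF measurable_pos[of k "{1..}"], of "carrier G - {\<one>\<^bsub>G\<^esub>}"]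
      by (simp add: sets_law sets_eq_imp_space_eq[OF sets_law])
    also have "pos k -` (carrier G - {\<one>\<^bsub>G\<^esub>}) \<inter> space law = {s \<in> space law. pos k s \<noteq> \<one>\<^bsub>G\<^esub>}"
      by auto
    finally show ?thesis .
  qed
  then show ?thesis
    unfolding escape_def
    by (intro sets.sets_Collect_countable_All sets.sets_Collect_imp sets.sets_Collect_const)
qed

definition last_visit :: "'a \<Rightarrow> nat \<Rightarrow> 'w set" where
  "last_visit x n = {\<omega> \<in> space M. pos n (\<lambda>i. g i \<omega>) = x \<and> shift n \<omega> \<in> escape}"

text \<open>By left cancellation, a walk at \<open>x\<close> at time \<open>n\<close> is at
  \<open>x\<close> again at time \<open>n + k\<close> exactly when the shifted walk is at the
  identity at time \<open>k\<close>.\<close>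

lemma last_visit_iff:
  assumes "x \<in> carrier G"
  shows "\<omega> \<in> last_visit x n \<longleftrightarrow>
    \<omega> \<in> space M \<and> pos n (\<lambda>i. g i \<omega>) = x \<and> (\<forall>m>n. pos m (\<lambda>i. g i \<omega>) \<noteq> x)"
proof -
  have space: "shift n \<omega> \<in> space law"
    by (auto simp: law_def space_PiM shift_def)
  have "pos k (shift n \<omega>) = \<one>\<^bsub>G\<^esub> \<longleftrightarrow> pos (n + k) (\<lambda>i. g i \<omega>) = x"
    if "pos n (\<lambda>i. g i \<omega>) = x" for k
    using that assms by (simp add: pos_add pos_shift)
  moreover have "(\<forall>m>n. P m) \<longleftrightarrow> (\<forall>k\<ge>1. P (n + k))" for P
    by (metis One_nat_def Suc_le_eq less_add_same_cancel1 less_imp_add_positive)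
  ultimately show ?thesis
    by (auto simp: last_visit_def escape_def space)
qed

lemma sets_last_visit: "last_visit x n \<in> events"
proof -
  have "shift n -` escape \<inter> space M \<in> events"
    using measurable_sets[OF measurable_shift] sets_escape by (simp add: sets_law)
  moreover have "last_visit x n =
      {\<omega> \<in> space M. pos n (\<lambda>i. g i \<omega>) = x} \<inter> (shift n -` escape \<inter> space M)"
    by (auto simp: last_visit_def)
  ultimately show ?thesis by simp
qed

text \<open>Last visits at distinct times are disjoint events, so their probabilities add up, and
  \<open>markov\<close> factors each of them.\<close>

lemma green_escape:
  assumes "x \<in> carrier G"
  shows "(\<Sum>n. emeasure M {\<omega> \<in> space M. pos n (\<lambda>i. g i \<omega>) = x}) * emeasure law escape =
    emeasure M (\<Union>n. last_visit x n)"
proof -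
  have "disjoint_family (last_visit x)"
    using assms by (auto simp: disjoint_family_on_def last_visit_iff) (metis nat_neq_iff)
  then have "emeasure M (\<Union>n. last_visit x n) = (\<Sum>n. emeasure M (last_visit x n))"
    by (intro suminf_emeasure[symmetric]) (auto simp: sets_last_visit)
  also have "\<dots> = (\<Sum>n. emeasure M {\<omega> \<in> space M. pos n (\<lambda>i. g i \<omega>) = x} * emeasure law escape)"
    by (simp add: last_visit_def markov[OF assms sets_escape])
  finally show ?thesis by simp
qed

lemma green_bound:
  assumes "AE \<omega> in M. finite {n. pos n (\<lambda>i. g i \<omega>) = \<one>\<^bsub>G\<^esub>}"
  obtains C :: ennreal where "C < \<infinity>"
    "\<And>x. x \<in> carrier G \<Longrightarrow> (\<Sum>n. emeasure M {\<omega> \<in> space M. pos n (\<lambda>i. g i \<omega>) = x}) \<le> C"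
proof (rule that[of "1 / emeasure law escape"])
  let ?q = "emeasure law escape"
  have "AE \<omega> in M. \<omega> \<in> (\<Union>n. last_visit \<one>\<^bsub>G\<^esub> n)"
    using assms AE_space
  proof eventually_elim
    case (elim \<omega>)
    let ?V = "{n. pos n (\<lambda>i. g i \<omega>) = \<one>\<^bsub>G\<^esub>}"
    \<comment> \<open>Time 0 is a visit, so the finite set of visits is nonempty and has a
      maximum.\<close>
    have "0 \<in> ?V"
      by simp
    with elim(1) have "Max ?V \<in> ?V"
      by (intro Max_in) blast+
    moreover have "m \<notin> ?V" if "m > Max ?V" for m
      using that Max_ge[OF elim(1), of m] by (meson leD)
    ultimately have "\<omega> \<in> last_visit \<one>\<^bsub>G\<^esub> (Max ?V)"
      unfolding last_visit_iff[OF one_closed] using elim(2) by blast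
    then show ?case
      by blast
  qed
  then have "emeasure M (\<Union>n. last_visit \<one>\<^bsub>G\<^esub> n) = 1"
    by (intro emeasure_eq_1_AE) (auto simp: sets_last_visit)
  \<comment> \<open>With \<open>?q = 0\<close> the product in \<open>green_escape\<close> would be 0
    even for an infinite sum, since 0 times infinity is 0 in \<open>ennreal\<close>.\<close>
  with green_escape[OF one_closed] have "?q \<noteq> 0"
    by auto
  then show "1 / ?q < \<infinity>"
    by (simp add: ennreal_divide_eq_top_iff less_top[symmetric])
  fix x assume x: "x \<in> carrier G"
  have "(\<Sum>n. emeasure M {\<omega> \<in> space M. pos n (\<lambda>i. g i \<omega>) = x}) * ?q \<le> 1"
    unfolding green_escape[OF x] by (rule emeasure_le_1)
  moreover have "?q \<noteq> \<top>"
    unfolding law_def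
    by (intro finite_measure.emeasure_finite prob_space.finite_measure prob_space_PiM prob_space_measure_pmf)
  ultimately show "(\<Sum>n. emeasure M {\<omega> \<in> space M. pos n (\<lambda>i. g i \<omega>) = x}) \<le> 1 / ?q"
    using \<open>?q \<noteq> 0\<close> divide_right_mono_ennreal[of "_ * ?q" 1 ?q]
    by (simp only: ennreal_mult_divide_eq not_False_eq_True)
qed

section \<open>Borel-Cantelli for sets attached to the increments\<close>

lemma emeasure_law_coordinate:
  assumes "i \<ge> 1"
  shows "emeasure law {s \<in> space law. P (s i)} = emeasure (measure_pmf \<mu>) {u. P u}"
proof -
  have "emeasure (distr law (measure_pmf \<mu>) (\<lambda>s. s i)) {u. P u} = emeasure (measure_pmf \<mu>) {u. P u}"
    using assms unfolding law_def by (subst distr_PiM_component) (auto simp: prob_space_measure_pmf)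
  moreover have "(\<lambda>s. s i) \<in> law \<rightarrow>\<^sub>M measure_pmf \<mu>"
    unfolding law_def using assms by (intro measurable_component_singleton) auto
  ultimately show ?thesis
    by (simp add: emeasure_distr vimage_def Int_def conj_commute)
qed

text \<open>With \<open>D\<close> the support of the permutation part, the increments eventually
  stop moving \<open>h\<close>. Splitting by position, the hitting probabilities sum to the Green
  function integrated against the chance that \<open>D\<close> is hit from \<open>x\<close>;
  bounding the Green function leaves the expected size of \<open>D\<close>.\<close>

lemma eventually_avoids:
  fixes D :: "'g \<Rightarrow> 'a set"
  assumes transient: "AE \<omega> in M. finite {n. pos n (\<lambda>i. g i \<omega>) = \<one>\<^bsub>G\<^esub>}"
    and D: "\<And>u. D u \<subseteq> carrier G"
    and integrable: "(\<integral>\<^sup>+u. emeasure (count_space UNIV) (D u) \<partial>measure_pmf \<mu>) < \<infinity>"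
    and h: "h \<in> carrier G"
  shows "AE \<omega> in M. \<forall>\<^sub>F n in sequentially. inv\<^bsub>G\<^esub> pos n (\<lambda>i. g i \<omega>) \<otimes>\<^bsub>G\<^esub> h \<notin> D (g (Suc n) \<omega>)"
proof -
  let ?S = "\<lambda>n \<omega>. pos n (\<lambda>i. g i \<omega>)"
  let ?p = "\<lambda>n x. emeasure M {\<omega> \<in> space M. ?S n \<omega> = x}"
  let ?r = "\<lambda>x. emeasure (measure_pmf \<mu>) {u. inv\<^bsub>G\<^esub> x \<otimes>\<^bsub>G\<^esub> h \<in> D u}"
  \<comment> \<open>Coordinate 1 of the shifted sequence is increment \<open>Suc n\<close>, the
    first one independent of the position at time \<open>n\<close>.\<close>
  define B where "B x = {s \<in> space law. inv\<^bsub>G\<^esub> x \<otimes>\<^bsub>G\<^esub> h \<in> D (s 1)}" for x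
  define E where "E n x = {\<omega> \<in> space M. ?S n \<omega> = x \<and> shift n \<omega> \<in> B x}" for n x
  define A where "A n = (\<Union>x\<in>carrier G. E n x)" for n
  obtain C where C: "C < \<infinity>" "\<And>x. x \<in> carrier G \<Longrightarrow> (\<Sum>n. ?p n x) \<le> C"
    using green_bound[OF transient] by blast
  have shift_in: "shift n \<omega> \<in> space law" for n \<omega>
    by (auto simp: law_def space_PiM shift_def)
  have sets_B: "B x \<in> sets law" for x
  proof -
    have "(\<lambda>s. s 1) \<in> law \<rightarrow>\<^sub>M measure_pmf \<mu>"
      unfolding law_def by (intro measurable_component_singleton) auto
    then have "(\<lambda>s. s 1) -` {u. inv\<^bsub>G\<^esub> x \<otimes>\<^bsub>G\<^esub> h \<in> D u} \<inter> space law \<in> sets law"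
      by (rule measurable_sets) simp
    also have "(\<lambda>s. s 1) -` {u. inv\<^bsub>G\<^esub> x \<otimes>\<^bsub>G\<^esub> h \<in> D u} \<inter> space law = B x"
      by (auto simp: B_def)
    finally show ?thesis .
  qed
  have law_B: "emeasure law (B x) = ?r x" for x
    unfolding B_def by (rule emeasure_law_coordinate) simp
  have sets_E: "E n x \<in> events" for n x
  proof -
    have "shift n -` B x \<inter> space M \<in> events"
      using measurable_sets[OF measurable_shift] sets_B by (simp add: sets_law)
    moreover have "E n x = {\<omega> \<in> space M. ?S n \<omega> = x} \<inter> (shift n -` B x \<inter> space M)"
      by (auto simp: E_def)
    ultimately show ?thesis by simp
  qed
  then have sets_A: "A n \<in> events" for n
    unfolding A_def by (intro sets.countable_UN' countable_carrier) auto
  have "emeasure M (A n) = (\<integral>\<^sup>+x. ?p n x * ?r x \<partial>count_space (carrier G))" for n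
  proof -
    have "emeasure M (A n) = (\<integral>\<^sup>+x. emeasure M (E n x) \<partial>count_space (carrier G))"
      unfolding A_def
      by (intro emeasure_UN_countable sets_E countable_carrier) (auto simp: disjoint_family_on_def E_def)
    also have "\<dots> = (\<integral>\<^sup>+x. ?p n x * ?r x \<partial>count_space (carrier G))"
      by (intro nn_integral_cong) (simp add: E_def markov sets_B law_B)
    finally show ?thesis .
  qed
  then have "(\<Sum>n. emeasure M (A n)) = (\<integral>\<^sup>+x. (\<Sum>n. ?p n x * ?r x) \<partial>count_space (carrier G))"
    by (simp only:) (rule nn_integral_suminf[symmetric], simp)
  \<comment> \<open>The Green bound is uniform in \<open>x\<close>, so it comes out as a
    constant.\<close>
  also have "\<dots> \<le> (\<integral>\<^sup>+x. C * ?r x \<partial>count_space (carrier G))"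
    by (intro nn_integral_mono) (auto intro: mult_right_mono C)
  also have "\<dots> = C * (\<integral>\<^sup>+x. ?r x \<partial>count_space (carrier G))"
    by (rule nn_integral_cmult) simp
  also have "(\<integral>\<^sup>+x. ?r x \<partial>count_space (carrier G)) =
      (\<integral>\<^sup>+x. \<integral>\<^sup>+u. indicator {x. inv\<^bsub>G\<^esub> x \<otimes>\<^bsub>G\<^esub> h \<in> D u} x \<partial>measure_pmf \<mu> \<partial>count_space (carrier G))"
  proof (intro nn_integral_cong)
    fix x
    have "?r x = (\<integral>\<^sup>+u. indicator {u. inv\<^bsub>G\<^esub> x \<otimes>\<^bsub>G\<^esub> h \<in> D u} u \<partial>measure_pmf \<mu>)"
      by simp
    then show "?r x = (\<integral>\<^sup>+u. indicator {x. inv\<^bsub>G\<^esub> x \<otimes>\<^bsub>G\<^esub> h \<in> D u} x \<partial>measure_pmf \<mu>)"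
      by (simp add: indicator_def)
  qed
  also have "\<dots> =
      (\<integral>\<^sup>+u. \<integral>\<^sup>+x. indicator {x. inv\<^bsub>G\<^esub> x \<otimes>\<^bsub>G\<^esub> h \<in> D u} x \<partial>count_space (carrier G) \<partial>measure_pmf \<mu>)"
    by (rule nn_integral_count_space_nn_integral[symmetric, OF countable_carrier]) simp
  also have "\<dots> = (\<integral>\<^sup>+u. emeasure (count_space UNIV) (D u) \<partial>measure_pmf \<mu>)"
  proof (intro nn_integral_cong)
    fix u
    \<comment> \<open>For fixed \<open>u\<close>, this bijection shows that the number of positions
      from which \<open>D u\<close> is hit is the size of \<open>D u\<close>.\<close>
    have "bij_betw (\<lambda>x. inv\<^bsub>G\<^esub> x \<otimes>\<^bsub>G\<^esub> h) (carrier G) (carrier G)"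
      by (rule bij_betw_byWitness[where f' = "\<lambda>y. h \<otimes>\<^bsub>G\<^esub> inv\<^bsub>G\<^esub> y"])
         (use h in \<open>auto simp: inv_mult_group m_assoc[symmetric]\<close>, simp_all add: m_assoc)
    then have "(\<integral>\<^sup>+x. indicator (D u) (inv\<^bsub>G\<^esub> x \<otimes>\<^bsub>G\<^esub> h) \<partial>count_space (carrier G)) =
        (\<integral>\<^sup>+y. indicator (D u) y \<partial>count_space (carrier G))"
      by (rule nn_integral_bij_count_space)
    also have "\<dots> = (\<integral>\<^sup>+y. indicator (D u) y \<partial>count_space UNIV)"
      using D by (intro nn_integral_count_space_eq) (auto simp: indicator_def)
    also have "\<dots> = emeasure (count_space UNIV) (D u)"
      by simp
    finally show "(\<integral>\<^sup>+x. indicator {x. inv\<^bsub>G\<^esub> x \<otimes>\<^bsub>G\<^esub> h \<in> D u} x \<partial>count_space (carrier G)) =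
        emeasure (count_space UNIV) (D u)"
      by (simp add: indicator_def)
  qed
  finally have "(\<Sum>n. emeasure M (A n)) < \<infinity>"
    using C(1) integrable by (simp add: ennreal_mult_less_top order_le_less_trans)
  then have "summable (\<lambda>n. prob (A n))"
    by (intro summable_suminf_not_top) (auto simp: emeasure_eq_measure)
  then have "AE \<omega> in M. \<forall>\<^sub>F n in sequentially. \<omega> \<in> space M - A n"
    by (intro borel_cantelli_AE1 sets_A) (auto simp: emeasure_eq_measure)
  then show ?thesis
  proof (rule AE_mp, intro AE_I2 impI)
    fix \<omega> assume "\<forall>\<^sub>F n in sequentially. \<omega> \<in> space M - A n"
    then show "\<forall>\<^sub>F n in sequentially. inv\<^bsub>G\<^esub> ?S n \<omega> \<otimes>\<^bsub>G\<^esub> h \<notin> D (g (Suc n) \<omega>)"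
    proof eventually_elim
      case (elim n)
      \<comment> \<open>The current position lies in the carrier, hence is one of the indices of the
        union \<open>A n\<close>.\<close>
      then have "shift n \<omega> \<notin> B (?S n \<omega>)"
        by (auto simp: A_def E_def)
      then show ?case
        by (simp add: B_def shift_in) (simp add: shift_def)
    qed
  qed
qed

end

section \<open>Stabilization of the permutation coordinate\<close>

theorem lemma4p5:
  fixes H :: "('a, 'm) monoid_scheme"
    and \<mu> :: "(('a \<Rightarrow> 'a) \<times> 'a) pmf"
    and M :: "'w measure"
    and g :: "nat \<Rightarrow> 'w \<Rightarrow> ('a \<Rightarrow> 'a) \<times> 'a"
  defines "F \<equiv> \<lambda>n \<omega>. fst (random_walk (Shuffler H) g n \<omega>)"
    and "S \<equiv> \<lambda>n \<omega>. snd (random_walk (Shuffler H) g n \<omega>)"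
  assumes "group H"
    and "countable (carrier H)"
    and "set_pmf \<mu> \<subseteq> carrier (Shuffler H)"
    and "prob_space M"
    and "iid_increments M \<mu> g"
    and "transient M H S"
    and "(\<integral>\<^sup>+(f, y). of_nat (card (supp H f)) \<partial>measure_pmf \<mu>) < \<infinity>"
  shows "AE \<omega> in M. \<forall>h\<in>carrier H. \<exists>N\<ge>1. \<forall>n\<ge>N. F n \<omega> h = F N \<omega> h"
proof -
  interpret H: group H by fact
  \<comment> \<open>The increments lie in the Shuffler only almost surely; the clamped steps always lie in \<open>H\<close>,
    so that the walk has a countable range and is measurable.\<close>
  define step where "step u = (if snd u \<in> carrier H then snd u else \<one>\<^bsub>H\<^esub>)" for u :: "('a \<Rightarrow> 'a) \<times> 'a"
  interpret M: prob_space M by fact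
  interpret iid_group_walk H M \<mu> g step
    by unfold_locales (use assms in \<open>auto simp: step_def\<close>)
  \<comment> \<open>On this almost sure event clamping changes no increment, so \<open>S\<close>
    agrees with \<open>pos\<close> at all times.\<close>
  have good: "AE \<omega> in M. \<forall>i\<ge>1. g i \<omega> \<in> set_pmf \<mu>"
  proof (subst AE_all_countable, intro allI)
    fix i :: nat
    show "AE \<omega> in M. i \<ge> 1 \<longrightarrow> g i \<omega> \<in> set_pmf \<mu>"
    proof (cases "i \<ge> 1")
      case True
      have "AE u in distr M (count_space UNIV) (g i). u \<in> set_pmf \<mu>"
        unfolding distr_increment[OF True] by (rule AE_measure_pmf)
      then show ?thesis
        by (subst (asm) AE_distr_iff) (use measurable_increment[OF True] in auto)
    qed simp
  qed
  have S_Suc: "S (Suc n) \<omega> = S n \<omega> \<otimes>\<^bsub>H\<^esub> snd (g (Suc n) \<omega>)" for n \<omega>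
    by (simp add: S_def snd_random_walk_Shuffler)
  have F_Suc: "F (Suc n) \<omega> = F n \<omega> \<circ> act H (S n \<omega>) (fst (g (Suc n) \<omega>))" for n \<omega>
    by (simp add: F_def S_def Shuffler_def split: prod.splits)
  have S_eq: "S n \<omega> = pos n (\<lambda>i. g i \<omega>)" if "\<forall>i\<ge>1. g i \<omega> \<in> set_pmf \<mu>" for n \<omega>
  proof (induction n)
    case 0
    then show ?case by (simp add: S_def Shuffler_def)
  next
    case (Suc n)
    have "g (Suc n) \<omega> \<in> carrier (Shuffler H)"
      using that assms(5) by auto
    then have "step (g (Suc n) \<omega>) = snd (g (Suc n) \<omega>)"
      by (auto simp: step_def Shuffler_def)
    with Suc show ?case
      by (simp add: S_Suc pos_Suc)
  qed
  have transient: "AE \<omega> in M. finite {n. pos n (\<lambda>i. g i \<omega>) = \<one>\<^bsub>H\<^esub>}"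
    using assms(8)[unfolded transient_def] good by eventually_elim (simp add: S_eq)
  \<comment> \<open>On infinite sets \<open>card\<close> is 0 but the counting measure is infinite;
    the two agree almost everywhere because permutations in the Shuffler have finite
    support.\<close>
  have "(\<integral>\<^sup>+u. emeasure (count_space UNIV) (supp H (fst u)) \<partial>measure_pmf \<mu>) =
      (\<integral>\<^sup>+(f, y). of_nat (card (supp H f)) \<partial>measure_pmf \<mu>)"
    using assms(5)
    by (intro nn_integral_cong_AE AE_pmfI) (auto simp: Shuffler_def FSym_def emeasure_count_space)
  with assms(9) have "AE \<omega> in M. \<forall>\<^sub>F n in sequentially.
      inv\<^bsub>H\<^esub> pos n (\<lambda>i. g i \<omega>) \<otimes>\<^bsub>H\<^esub> h \<notin> supp H (fst (g (Suc n) \<omega>))" if "h \<in> carrier H" for h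
    using that by (intro eventually_avoids transient) (auto simp: supp_def)
  then have "AE \<omega> in M. \<forall>h\<in>carrier H. \<forall>\<^sub>F n in sequentially.
      inv\<^bsub>H\<^esub> pos n (\<lambda>i. g i \<omega>) \<otimes>\<^bsub>H\<^esub> h \<notin> supp H (fst (g (Suc n) \<omega>))"
    by (simp add: AE_ball_countable[OF assms(4)])
  with good show ?thesis
  proof eventually_elim
    case (elim \<omega>)
    show ?case
    proof
      fix h assume h: "h \<in> carrier H"
      obtain N where N: "\<And>n. n \<ge> N \<Longrightarrow> inv\<^bsub>H\<^esub> S n \<omega> \<otimes>\<^bsub>H\<^esub> h \<notin> supp H (fst (g (Suc n) \<omega>))"
        using bspec[OF elim(2) h] unfolding eventually_sequentially S_eq[OF elim(1)] by blast
      \<comment> \<open>The new permutation fixes the translate of \<open>h\<close> by the inverse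
        position, so its translate under \<open>act\<close> fixes \<open>h\<close>, and composing
        with it keeps the image of \<open>h\<close>.\<close>
      have F_step: "F (Suc n) \<omega> h = F n \<omega> h" if "n \<ge> N" for n
      proof -
        have S: "S n \<omega> \<in> carrier H"
          by (simp add: S_eq[OF elim(1)])
        then have "fst (g (Suc n) \<omega>) (inv\<^bsub>H\<^esub> S n \<omega> \<otimes>\<^bsub>H\<^esub> h) = inv\<^bsub>H\<^esub> S n \<omega> \<otimes>\<^bsub>H\<^esub> h"
          using N[OF that] h by (simp add: supp_def)
        moreover have "S n \<omega> \<otimes>\<^bsub>H\<^esub> (inv\<^bsub>H\<^esub> S n \<omega> \<otimes>\<^bsub>H\<^esub> h) = h"
          using S h by (simp add: H.m_assoc[symmetric])
        ultimately show ?thesis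
          using h by (simp add: F_Suc act_def)
      qed
      \<comment> \<open>\<open>Suc N\<close> replaces \<open>N\<close> because the witness has to be
        at least 1.\<close>
      have "F n \<omega> h = F (Suc N) \<omega> h" if "n \<ge> Suc N" for n
        using that
      proof (induction n rule: dec_induct)
        case (step n)
        then show ?case
          using F_step[of n] by (metis Suc_leD)
      qed simp
      then show "\<exists>N\<ge>1. \<forall>n\<ge>N. F n \<omega> h = F N \<omega> h"
        by (metis One_nat_def Suc_le_mono le0)
    qed
  qed
qed

end
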